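(* Let $H$ be a group, $a\in H$, let $v$ be a non-negative integer, and let $\beta=\langle\beta_1\ldots\beta_\ell\rangle$ be a Fibonacci representation of $v$. Define elements of $H$ by $(d_{\ell+1},e_{\ell+1})=(1,1)$ and, for $i=\ell,\ell-1,\ldots,1$, $$d_i=e_{i+1}\,a^{\beta_i},\qquad e_i=d_{i+1}\,e_{i+1}\,a^{\beta_i}.$$ (Equivalently, $d_i=a^{u_i}$, $e_i=a^{v_i}$ with $u_{\ell+1}=v_{\ell+1}=0$, $u_i=v_{i+1}+\beta_i$, $v_i=u_{i+1}+v_{i+1}+\beta_i$.) Then $(d_1,e_1)=(a^{G(v)},a^{v})$.
   Context: $F_0=0$, $F_1=1$, $F_i=F_{i-1}+F_{i-2}$ are the Fibonacci numbers and $\phi=(1+\sqrt5)/2$. A bit string $\beta=\langle\beta_1\ldots\beta_\ell\rangle$ has $\beta_i\in\{0,1\}$; its Fibonacci sum is $\mathrm{FibSum}(\beta)=\sum_{i=1}^{\ell}\beta_iF_{i+1}$, and $\beta$ is a Fibonacci representation of $n$ if $\mathrm{FibSum}(\beta)=n$ (the empty string represents $0$). Hofstadter's G function is $G(x)=\lfloor\phi^{-1}(x+1)\rfloor$ for integers $x\ge 0$ (this coincides with the recursion $G(0)=0$, $G(1)=1$, $G(x)=x-G(G(x-1))$). The group operation is written multiplicatively with identity $1$. *)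

theory Defs
  imports Complex_Main "HOL-Algebra.Group" "HOL-Number_Theory.Fib"
begin

definition phi :: real where
  "phi = (1 + sqrt 5) / 2"

definition hofstadter_G :: "nat \<Rightarrow> nat" where
  "hofstadter_G x = nat \<lfloor>inverse phi * (real x + 1)\<rfloor>"

text \<open>A string \<open>\<langle>\<beta>\<^sub>1 \<dots> \<beta>\<^sub>\<ell>\<rangle>\<close> is a list written from left to right; lists are indexed
  from \<open>0\<close>, so the one-based entry \<open>\<beta>\<^sub>i\<close> is \<open>\<beta> ! (i - 1)\<close>.\<close>

definition bit_at :: "nat list \<Rightarrow> nat \<Rightarrow> nat" where
  "bit_at \<beta> i = \<beta> ! (i - 1)"

definition bit_string :: "nat list \<Rightarrow> bool" where
  "bit_string \<beta> \<longleftrightarrow> (\<forall>i\<in>{1..length \<beta>}. bit_at \<beta> i \<in> {0, 1})"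

definition fib_sum :: "nat list \<Rightarrow> nat" where
  "fib_sum \<beta> = (\<Sum>i = 1..length \<beta>. bit_at \<beta> i * fib (i + 1))"

text \<open>No canonicity is required: trailing zeros and adjacent ones are allowed.\<close>

definition fib_representation :: "nat list \<Rightarrow> nat \<Rightarrow> bool" where
  "fib_representation \<beta> n \<longleftrightarrow> bit_string \<beta> \<and> fib_sum \<beta> = n"

end

theory Submission imports Defs begin

text \<open>
  The exponents are \<open>u\<^sub>i = \<Sum>\<^bsub>j\<ge>i\<^esub> \<beta>\<^sub>j F\<^bsub>j-i+1\<^esub>\<close> and \<open>v\<^sub>i = \<Sum>\<^bsub>j\<ge>i\<^esub> \<beta>\<^sub>j F\<^bsub>j-i+2\<^esub>\<close>, so
  \<open>v\<^sub>1 = v\<close>. Put \<open>\<psi> = \<phi>\<^sup>-\<^sup>1\<close>, so that \<open>\<psi>\<^sup>2 = 1 - \<psi>\<close>. The error \<open>\<delta>\<^sub>i = u\<^sub>i - \<psi> v\<^sub>i\<close> satisfies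
  \<open>\<delta>\<^sub>i = - \<psi> \<delta>\<^bsub>i+1\<^esub> + \<psi>\<^sup>2 \<beta>\<^sub>i\<close>, and for \<open>\<beta>\<^sub>i \<in> {0, 1}\<close> this map sends the interval
  \<open>(\<psi> - 1, \<psi>)\<close> into itself. Hence \<open>u\<^sub>1 < \<psi> (v + 1) < u\<^sub>1 + 1\<close>, that is, \<open>u\<^sub>1 = G(v)\<close>.
\<close>

lemma inverse_phi_pos: "0 < inverse phi"
  and inverse_phi_less_one: "inverse phi < 1"
  and inverse_phi_square: "inverse phi * inverse phi = 1 - inverse phi"
proof -
  have "phi > 1"
    by (simp add: phi_def)
  moreover have "phi * phi = phi + 1"
    by (simp add: phi_def field_simps)
  ultimately show "0 < inverse phi" "inverse phi < 1"
      "inverse phi * inverse phi = 1 - inverse phi"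
    by (simp_all add: field_simps)
qed

lemma golden_error_step:
  fixes u v b :: nat
  assumes "b \<in> {0, 1}"
    and "inverse phi - 1 < real u - inverse phi * real v"
    and "real u - inverse phi * real v < inverse phi"
  shows "inverse phi - 1 < real (v + b) - inverse phi * real (u + v + b)"
    and "real (v + b) - inverse phi * real (u + v + b) < inverse phi"
proof -
  define p where "p = inverse phi"
  define x where "x = real u - p * real v"
  have p: "0 < p" "p < 1" "p * p = 1 - p"
    using inverse_phi_pos inverse_phi_less_one inverse_phi_square by (simp_all add: p_def)
  have vpp: "p * (p * real v) = real v - p * real v"
    using p(3) by (metis left_diff_distrib mult.assoc mult_1)
  have eq: "real (v + b) - p * real (u + v + b) = - (p * x) + (1 - p) * real b"
    by (simp add: x_def algebra_simps vpp)
  have "p * (p - 1) < p * x" "p * x < p * p"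
    using assms(2,3) p(1) by (simp_all add: p_def x_def)
  then have "p * x < 1 - p" "1 - 2 * p < p * x"
    using p(3) by (simp_all add: algebra_simps)
  \<comment> \<open>For \<open>b = 0\<close> the value lies between \<open>p - 1\<close> and
    \<open>2 * p - 1\<close>, for \<open>b = 1\<close> between \<open>0\<close> and
    \<open>p\<close>; as \<open>0 < p < 1\<close>, both ranges stay inside the interval.\<close>
  then have "p - 1 < - (p * x) + (1 - p) * real b \<and> - (p * x) + (1 - p) * real b < p"
    using assms(1) p(2) by auto
  with eq show "inverse phi - 1 < real (v + b) - inverse phi * real (u + v + b)"
      "real (v + b) - inverse phi * real (u + v + b) < inverse phi"
    by (simp_all add: p_def)
qed

lemma hofstadter_G_eqI:
  assumes "inverse phi - 1 < real u - inverse phi * real v"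
    and "real u - inverse phi * real v < inverse phi"
  shows "hofstadter_G v = u"
proof -
  have "\<lfloor>inverse phi * (real v + 1)\<rfloor> = int u"
    using assms by (intro floor_unique) (simp_all add: algebra_simps)
  then show ?thesis
    by (simp add: hofstadter_G_def)
qed

text \<open>A predicate on arbitrary \<open>us\<close> and \<open>vs\<close>, so that the Fibonacci
  sums and any solution given in the theorem are treated alike.\<close>

definition exponent_recurrence :: "nat list \<Rightarrow> (nat \<Rightarrow> nat) \<Rightarrow> (nat \<Rightarrow> nat) \<Rightarrow> bool" where
  "exponent_recurrence \<beta> us vs \<longleftrightarrow>
    us (length \<beta> + 1) = 0 \<and> vs (length \<beta> + 1) = 0 \<and>
    (\<forall>i\<in>{1..length \<beta>}. us i = vs (i + 1) + bit_at \<beta> i \<and>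
                         vs i = us (i + 1) + vs (i + 1) + bit_at \<beta> i)"

text \<open>Downward induction from \<open>length \<beta> + 1\<close>, where the error is
  \<open>0\<close>, an interior point of the interval.\<close>

lemma exponent_recurrence_error:
  assumes "exponent_recurrence \<beta> us vs" and "bit_string \<beta>" and "1 \<le> i" and "i \<le> length \<beta> + 1"
  shows "inverse phi - 1 < real (us i) - inverse phi * real (vs i) \<and>
    real (us i) - inverse phi * real (vs i) < inverse phi"
  using assms(4,3)
proof (induction rule: inc_induct)
  case base
  then show ?case
    using assms(1) inverse_phi_pos inverse_phi_less_one by (simp add: exponent_recurrence_def)
next
  case (step n)
  then have "n \<in> {1..length \<beta>}"
    by simp
  with assms(1,2) have "bit_at \<beta> n \<in> {0, 1}" "us n = vs (Suc n) + bit_at \<beta> n"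
      "vs n = us (Suc n) + vs (Suc n) + bit_at \<beta> n"
    by (auto simp: exponent_recurrence_def bit_string_def)
  with step golden_error_step[of "bit_at \<beta> n" "us (Suc n)" "vs (Suc n)"] show ?case
    by simp
qed

lemma exponent_recurrence_fib:
  "exponent_recurrence \<beta>
    (\<lambda>i. \<Sum>j = i..length \<beta>. bit_at \<beta> j * fib (j + 1 - i))
    (\<lambda>i. \<Sum>j = i..length \<beta>. bit_at \<beta> j * fib (j + 2 - i))"
proof -
  \<comment> \<open>For \<open>j > i\<close> this is the Fibonacci recurrence with indices
    \<open>j - i + 2\<close>, \<open>j - i\<close>, \<open>j - i + 1\<close>; the term
    \<open>j = i\<close> has weight \<open>1\<close> in both sums.\<close>
  have "(\<Sum>j = Suc i..length \<beta>. bit_at \<beta> j * fib (j + 2 - i)) =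
      (\<Sum>j = Suc i..length \<beta>. bit_at \<beta> j * fib (j + 1 - Suc i)) +
      (\<Sum>j = Suc i..length \<beta>. bit_at \<beta> j * fib (j + 2 - Suc i))" for i
    unfolding sum.distrib[symmetric]
    by (rule sum.cong) (auto simp: Suc_diff_le distrib_left)
  then show ?thesis
    by (simp add: exponent_recurrence_def sum.atLeast_Suc_atMost)
qed

text \<open>All factors are powers of \<open>a\<close>, so each product adds exponents; downward
  induction again.\<close>

lemma (in monoid) exponent_recurrence_pow:
  assumes "a \<in> carrier G"
    and "d (length \<beta> + 1) = \<one>" and "e (length \<beta> + 1) = \<one>"
    and "\<And>i. i \<in> {1..length \<beta>} \<Longrightarrow> d i = e (i + 1) \<otimes> a [^] bit_at \<beta> i"
    and "\<And>i. i \<in> {1..length \<beta>} \<Longrightarrow> e i = d (i + 1) \<otimes> e (i + 1) \<otimes> a [^] bit_at \<beta> i"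
    and "exponent_recurrence \<beta> us vs" and "1 \<le> i" and "i \<le> length \<beta> + 1"
  shows "d i = a [^] us i \<and> e i = a [^] vs i"
  using assms(8,7)
proof (induction rule: inc_induct)
  case base
  then show ?case
    using assms(2,3,6) by (simp add: exponent_recurrence_def)
next
  case (step n)
  then have n: "n \<in> {1..length \<beta>}"
    by simp
  with assms(6) have "us n = vs (Suc n) + bit_at \<beta> n"
      "vs n = us (Suc n) + vs (Suc n) + bit_at \<beta> n"
    by (auto simp: exponent_recurrence_def)
  with step assms(1) assms(4,5)[OF n] show ?case
    by (simp add: nat_pow_mult)
qed

theorem theorem1:
  fixes H :: "('g, 'm) monoid_scheme" (structure)
    and a :: 'g and v :: nat and \<beta> :: "nat list" and d e :: "nat \<Rightarrow> 'g"
  assumes "group H"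
    and "a \<in> carrier H"
    and "fib_representation \<beta> v"
    and "d (length \<beta> + 1) = \<one>" and "e (length \<beta> + 1) = \<one>"
    and "\<And>i. i \<in> {1..length \<beta>} \<Longrightarrow> d i = e (i + 1) \<otimes> a [^] bit_at \<beta> i"
    and "\<And>i. i \<in> {1..length \<beta>} \<Longrightarrow> e i = d (i + 1) \<otimes> e (i + 1) \<otimes> a [^] bit_at \<beta> i"
  shows "(d 1, e 1) = (a [^] hofstadter_G v, a [^] v) \<and>
    (\<forall>us vs :: nat \<Rightarrow> nat.
      us (length \<beta> + 1) = 0 \<and> vs (length \<beta> + 1) = 0 \<and>
      (\<forall>i\<in>{1..length \<beta>}. us i = vs (i + 1) + bit_at \<beta> i \<and>
                           vs i = us (i + 1) + vs (i + 1) + bit_at \<beta> i)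
      \<longrightarrow> (\<forall>i\<in>{1..length \<beta> + 1}. d i = a [^] us i \<and> e i = a [^] vs i))"
proof -
  interpret group H
    by fact
  note pow = exponent_recurrence_pow[where d = d and e = e, OF assms(2,4-7)]
  define us where "us = (\<lambda>i. \<Sum>j = i..length \<beta>. bit_at \<beta> j * fib (j + 1 - i))"
  define vs where "vs = (\<lambda>i. \<Sum>j = i..length \<beta>. bit_at \<beta> j * fib (j + 2 - i))"
  have rec: "exponent_recurrence \<beta> us vs"
    unfolding us_def vs_def by (rule exponent_recurrence_fib)
  \<comment> \<open>At \<open>i = 1\<close> the weight \<open>fib (j + 2 - i)\<close> becomes
    \<open>fib (j + 1)\<close>, the one in \<open>fib_sum\<close>.\<close>
  have "vs 1 = v"
    using assms(3) by (simp add: vs_def fib_representation_def fib_sum_def)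
  moreover have "hofstadter_G (vs 1) = us 1"
    using exponent_recurrence_error[OF rec, of 1] assms(3)
    by (intro hofstadter_G_eqI) (simp_all add: fib_representation_def)
  ultimately have "(d 1, e 1) = (a [^] hofstadter_G v, a [^] v)"
    using pow[OF _ _ rec, of 1] by simp
  moreover have "d i = a [^] us' i \<and> e i = a [^] vs' i"
    if "exponent_recurrence \<beta> us' vs'" "i \<in> {1..length \<beta> + 1}" for us' vs' i
    using pow[OF _ _ that(1)] that(2) by simp
  ultimately show ?thesis
    unfolding exponent_recurrence_def by blast
qed

end
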